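(* For every integer $n\ge 4$, $f_{n-2}(n)\ge n-3$.
   Context: For $1\le j\le n$, $\sigma_j(x_1,\dots,x_n)=\sum_{1\le i_1<\dots<i_j\le n}x_{i_1}\cdots x_{i_j}$. For $n\ge 3$, $f_{n-2}(n)$ is the (finite) number of $n$-tuples of integers $(x_1,\dots,x_n)$ with $1\le x_1\le\dots\le x_n$ and $\sigma_{n-2}(x_1,\dots,x_n)=\sigma_n(x_1,\dots,x_n)$ (equivalently, $\sum_{1\le i<j\le n}\frac{1}{x_ix_j}=1$). *)

theory Defs
  imports Main
begin

(* An n-tuple is a list of length n, indexed from 0. An index choice
   i_1 < ... < i_j is identified with the j-element set {i_1, ..., i_j}. *)
definition elem_sym :: "nat \<Rightarrow> int list \<Rightarrow> int" where
  "elem_sym j xs = (\<Sum>I | I \<subseteq> {..<length xs} \<and> card I = j. \<Prod>i\<in>I. xs ! i)"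

definition sym_solutions :: "nat \<Rightarrow> nat \<Rightarrow> int list set" where
  "sym_solutions k n =
     {xs. length xs = n \<and> sorted xs \<and> (\<forall>x\<in>set xs. 1 \<le> x) \<and> elem_sym k xs = elem_sym n xs}"

(* card is 0 on infinite sets, so a positive lower bound on num_solutions
   entails that the solution set is finite. *)
definition num_solutions :: "nat \<Rightarrow> nat \<Rightarrow> nat" where
  "num_solutions k n = card (sym_solutions k n)"

end

theory Submission
  imports Defs
begin

text \<open>
  Write \<open>P\<close>, \<open>A\<close>, \<open>B\<close> for \<open>\<sigma>\<^sub>m\<close>, \<open>\<sigma>\<^bsub>m-1\<^esub>\<close>, \<open>\<sigma>\<^bsub>m-2\<^esub>\<close> of an \<open>m\<close>-tuple \<open>xs\<close>, and call \<open>P - B\<close> its gap.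
  Appending \<open>x\<close> turns the gap \<open>d\<close> into \<open>x d - A\<close>. So from a tuple of gap 1, appending \<open>A\<close> gives a
  solution, and appending \<open>A + 1\<close> gives a tuple of gap 1 again. Appending \<open>u, v\<close> keeps the gap 1
  exactly when \<open>(u - A) (v - A) = A\<^sup>2 + P + 1\<close>. If \<open>5\<close> divides \<open>P\<close> and \<open>A \<equiv> 2 (mod 5)\<close>, the right-hand side
  is divisible by 5, which yields a second extension by two entries; and these congruences
  recur after appending \<open>A + 1\<close> twice. Two such tuples of length 5 give two new tuples of gap 1
  for every second length.
\<close>

section \<open>Elementary symmetric functions under appending an entry\<close>

lemma elem_sym_0 [simp]: "elem_sym 0 xs = 1"
proof -
  have "{I. I \<subseteq> {..<length xs} \<and> card I = 0} = {{}}"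
    by (auto dest: finite_subset)
  then show ?thesis by (simp add: elem_sym_def)
qed

lemma elem_sym_gt_length: "length xs < j \<Longrightarrow> elem_sym j xs = 0"
proof -
  assume "length xs < j"
  then have "card I \<noteq> j" if "I \<subseteq> {..<length xs}" for I
    using card_mono[OF _ that] by auto
  then have "{I. I \<subseteq> {..<length xs} \<and> card I = j} = {}" by blast
  then show ?thesis unfolding elem_sym_def by (simp only: sum.empty)
qed

text \<open>An index set of size \<open>Suc j\<close> either avoids the new last index or arises
  from one of size \<open>j\<close> by inserting it.\<close>

lemma elem_sym_snoc:
  "elem_sym (Suc j) (xs @ [x]) = elem_sym (Suc j) xs + x * elem_sym j xs"
proof -
  define n where "n = length xs"
  define S where "S k = {I. I \<subseteq> {..<n} \<and> card I = k}" for k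
  have fin: "finite (S k)" for k
    unfolding S_def by (rule finite_subset[of _ "Pow {..<n}"]) auto
  have S: "finite I" "n \<notin> I" if "I \<in> S k" for I k
    using that finite_subset[of I "{..<n}"] by (auto simp: S_def)
  have split: "{I. I \<subseteq> {..<Suc n} \<and> card I = Suc j} = S (Suc j) \<union> insert n ` S j"
  proof (intro equalityI subsetI)
    fix I assume I: "I \<in> {I. I \<subseteq> {..<Suc n} \<and> card I = Suc j}"
    show "I \<in> S (Suc j) \<union> insert n ` S j"
    proof (cases "n \<in> I")
      case True
      with I have "I - {n} \<in> S j" by (auto simp: S_def)
      moreover from True have "I = insert n (I - {n})" by auto
      ultimately show ?thesis by blast
    next
      case False
      with I show ?thesis by (auto simp: S_def less_Suc_eq)
    qed
  next
    fix I assume "I \<in> S (Suc j) \<union> insert n ` S j"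
    then show "I \<in> {I. I \<subseteq> {..<Suc n} \<and> card I = Suc j}"
    proof
      assume "I \<in> S (Suc j)"
      then show ?thesis by (auto simp: S_def)
    next
      assume "I \<in> insert n ` S j"
      then obtain J where J: "J \<in> S j" "I = insert n J" by auto
      with S[OF J(1)] show ?thesis by (auto simp: S_def)
    qed
  qed
  have inj: "inj_on (insert n) (S j)"
    by (rule inj_onI) (metis S(2) insert_ident)
  have old: "(\<Prod>i\<in>I. (xs @ [x]) ! i) = (\<Prod>i\<in>I. xs ! i)" if "I \<in> S k" for I k
    using that by (intro prod.cong) (auto simp: S_def n_def nth_append)
  have "elem_sym (Suc j) (xs @ [x])
      = (\<Sum>I\<in>S (Suc j). \<Prod>i\<in>I. (xs @ [x]) ! i) + (\<Sum>I\<in>insert n ` S j. \<Prod>i\<in>I. (xs @ [x]) ! i)"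
  proof -
    have "S (Suc j) \<inter> insert n ` S j = {}" using S(2) by blast
    then show ?thesis
      using sum.union_disjoint[OF fin finite_imageI[OF fin]]
      by (simp only: elem_sym_def length_append_singleton n_def[symmetric] split)
  qed
  also have "(\<Sum>I\<in>S (Suc j). \<Prod>i\<in>I. (xs @ [x]) ! i) = elem_sym (Suc j) xs"
    unfolding elem_sym_def n_def[symmetric] S_def[symmetric] by (intro sum.cong) (auto simp: old)
  also have "(\<Sum>I\<in>insert n ` S j. \<Prod>i\<in>I. (xs @ [x]) ! i) = (\<Sum>I\<in>S j. x * (\<Prod>i\<in>I. xs ! i))"
    unfolding sum.reindex[OF inj] o_def
  proof (intro sum.cong refl)
    fix I assume "I \<in> S j"
    with S[OF this] old[OF this]
    show "(\<Prod>i\<in>insert n I. (xs @ [x]) ! i) = x * (\<Prod>i\<in>I. xs ! i)"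
      by (simp add: n_def)
  qed
  also have "\<dots> = x * elem_sym j xs"
    unfolding elem_sym_def n_def[symmetric] S_def[symmetric] by (simp add: sum_distrib_left)
  finally show ?thesis .
qed

text \<open>
  The \<open>P\<close>, \<open>A\<close>, \<open>B\<close> above are \<open>co_sym\<close> 0, 1, 2. The conditional is needed because truncated subtraction
  would give \<open>\<sigma>\<^sub>0 = 1\<close> instead of 0 on tuples shorter than \<open>j\<close>.
\<close>

definition co_sym :: "nat \<Rightarrow> int list \<Rightarrow> int" where
  "co_sym j xs = (if j \<le> length xs then elem_sym (length xs - j) xs else 0)"

definition gap :: "int list \<Rightarrow> int" where
  "gap xs = co_sym 0 xs - co_sym 2 xs"

lemma co_sym_Nil [simp]: "co_sym 0 [] = 1" "co_sym (Suc j) [] = 0"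
  by (simp_all add: co_sym_def)

lemma co_sym_0_snoc [simp]: "co_sym 0 (xs @ [x]) = x * co_sym 0 xs"
  by (simp add: co_sym_def elem_sym_snoc elem_sym_gt_length)

lemma co_sym_Suc_snoc [simp]: "co_sym (Suc j) (xs @ [x]) = co_sym j xs + x * co_sym (Suc j) xs"
proof (cases "Suc j \<le> length xs")
  case True
  then obtain k where "length xs - j = Suc k" "length xs - Suc j = k"
    by (metis Suc_diff_Suc Suc_le_lessD)
  with True show ?thesis by (simp add: co_sym_def elem_sym_snoc)
qed (auto simp: co_sym_def)

lemma gap_Nil [simp]: "gap [] = 1"
  by (simp add: gap_def numeral_2_eq_2)

lemma gap_snoc [simp]: "gap (xs @ [x]) = x * gap xs - co_sym (Suc 0) xs"
  by (simp add: gap_def numeral_2_eq_2 algebra_simps)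

lemma gap_eq_0_iff:
  "length xs = n \<Longrightarrow> 2 \<le> n \<Longrightarrow> gap xs = 0 \<longleftrightarrow> elem_sym (n - 2) xs = elem_sym n xs"
  by (auto simp: gap_def co_sym_def)

text \<open>For evaluating explicit tuples: one pass over the list updates \<open>P\<close>,
  \<open>A\<close> and the gap, starting from their values on the empty list.\<close>

lemma co_sym_foldl:
  "foldl (\<lambda>(p, a, d) x. (x * p, p + x * a, x * d - a)) (1, 0, 1) xs
     = (co_sym 0 xs, co_sym (Suc 0) xs, gap xs)"
  by (induction xs rule: rev_induct) auto

section \<open>Size estimates for entries at least 1\<close>

lemma co_sym_0_pos: "\<forall>x\<in>set xs. 1 \<le> x \<Longrightarrow> 1 \<le> co_sym 0 xs"
proof (induction xs rule: rev_induct)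
  case (snoc x xs)
  then have "1 * 1 \<le> x * co_sym 0 xs" by (intro mult_mono) auto
  then show ?case by simp
qed simp

lemma co_sym_1_nonneg: "\<forall>x\<in>set xs. 1 \<le> x \<Longrightarrow> 0 \<le> co_sym (Suc 0) xs"
proof (induction xs rule: rev_induct)
  case (snoc x xs)
  then show ?case using co_sym_0_pos[of xs] by auto
qed simp

lemma co_sym_1_pos: "\<forall>x\<in>set xs. 1 \<le> x \<Longrightarrow> xs \<noteq> [] \<Longrightarrow> 1 \<le> co_sym (Suc 0) xs"
proof (induction xs rule: rev_induct)
  case (snoc x xs)
  then have "0 \<le> x * co_sym (Suc 0) xs" using co_sym_1_nonneg[of xs] by simp
  then show ?case using snoc co_sym_0_pos[of xs] by simp
qed simp

text \<open>Each summand of \<open>A\<close> is the full product with one entry, at least 1, left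
  out.\<close>

lemma co_sym_1_le:
  "\<forall>x\<in>set xs. 1 \<le> x \<Longrightarrow> co_sym (Suc 0) xs \<le> int (length xs) * co_sym 0 xs"
proof (induction xs rule: rev_induct)
  case (snoc x xs)
  then have "x * co_sym (Suc 0) xs \<le> x * (int (length xs) * co_sym 0 xs)"
    by (intro mult_left_mono) auto
  moreover have "1 * co_sym 0 xs \<le> x * co_sym 0 xs"
    using snoc.prems co_sym_0_pos[of xs] by (intro mult_right_mono) auto
  ultimately show ?case by (simp add: algebra_simps)
qed simp

subsection \<open>Finiteness\<close>

text \<open>
  For a solution \<open>ys @ zs\<close> the right-hand side below is 0. As the gap of the proper prefix \<open>ys\<close> is
  at least 1, this bounds \<open>c\<close>, taken to be the first entry of \<open>zs\<close>, in terms of \<open>ys\<close>.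
\<close>

lemma gap_append_lower:
  assumes "\<forall>x\<in>set (ys @ zs). 1 \<le> x" "\<forall>z\<in>set zs. c \<le> z" "0 \<le> c" "length (ys @ zs) \<le> N"
  shows "prod_list zs * (c * gap ys - int (length zs) * int N * co_sym 0 ys) \<le> c * gap (ys @ zs)"
  using assms
proof (induction zs rule: rev_induct)
  case (snoc z zs)
  let ?R = "prod_list zs" and ?p = "co_sym 0 ys" and ?A = "co_sym (Suc 0) (ys @ zs)"
  have p: "co_sym 0 (ys @ zs) = ?R * ?p"
    by (induction zs rule: rev_induct) (simp_all flip: append_assoc)
  have z: "1 \<le> z" "c \<le> z" using snoc.prems by auto
  have pos: "0 \<le> ?R * ?p" using co_sym_0_pos[of "ys @ zs"] snoc.prems p by auto
  have "?A \<le> int (length (ys @ zs)) * (?R * ?p)"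
    using co_sym_1_le[of "ys @ zs"] snoc.prems p by simp
  also have "\<dots> \<le> int N * (?R * ?p)"
    using snoc.prems pos by (intro mult_right_mono) auto
  \<comment> \<open>Appending \<open>z\<close> costs \<open>A\<close> in the gap. Since
    \<open>c \<le> z\<close>, this loss times \<open>c\<close> is covered by one more summand
    \<open>N * ?p\<close>, scaled by the new product \<open>z * ?R\<close>.\<close>
  finally have "c * ?A \<le> c * (int N * (?R * ?p))"
    using snoc.prems by (intro mult_left_mono) auto
  also have "\<dots> \<le> z * (int N * (?R * ?p))"
    using z pos by (intro mult_right_mono) auto
  finally have A: "c * ?A \<le> z * (int N * (?R * ?p))" .
  have "?R * (c * gap ys - int (length zs) * int N * ?p) \<le> c * gap (ys @ zs)"
    using snoc by auto
  then have "z * (?R * (c * gap ys - int (length zs) * int N * ?p)) \<le> z * (c * gap (ys @ zs))"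
    using z by (intro mult_left_mono) auto
  with A show ?case by (simp add: algebra_simps flip: append_assoc)
qed simp

text \<open>Each appended entry multiplies a nonpositive gap by a positive number and then subtracts
  \<open>A\<close>, which is at least 1 on a nonempty tuple.\<close>

lemma gap_append_nonpos:
  assumes "\<forall>x\<in>set (ys @ zs). 1 \<le> x" "gap ys \<le> 0" "ys \<noteq> []" "zs \<noteq> []"
  shows "gap (ys @ zs) < 0"
  using assms
proof (induction zs rule: rev_induct)
  case (snoc z zs)
  have "gap (ys @ zs) \<le> 0" using snoc by (cases "zs = []") auto
  moreover have "1 \<le> co_sym (Suc 0) (ys @ zs)" using snoc by (intro co_sym_1_pos) auto
  moreover have "0 \<le> z" using snoc by auto
  ultimately have "z * gap (ys @ zs) - co_sym (Suc 0) (ys @ zs) < 0"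
    using mult_nonneg_nonpos[of z "gap (ys @ zs)"] by linarith
  then show ?case by (simp flip: append_assoc)
qed simp

lemma sym_solutions_nth_le:
  assumes "xs \<in> sym_solutions (n - 2) n" "2 \<le> n" "k < n"
  shows "xs ! k \<le> int n * int n * co_sym 0 (take k xs)"
proof -
  define ys zs where "ys = take k xs" and "zs = drop k xs"
  have xs: "length xs = n" "sorted xs" "\<forall>x\<in>set xs. 1 \<le> x" "xs = ys @ zs"
    using assms by (auto simp: sym_solutions_def ys_def zs_def)
  have gap: "gap (ys @ zs) = 0"
    using assms gap_eq_0_iff[of xs n] xs by (auto simp: sym_solutions_def)
  have ge: "\<forall>x\<in>set (ys @ zs). 1 \<le> x" using xs by simp
  have c: "1 \<le> xs ! k" using xs(1,3) assms(3) by (metis nth_mem)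
  have zs: "zs \<noteq> []" "length zs \<le> n" using assms(3) xs(1) by (auto simp: zs_def)
  have le: "\<forall>z\<in>set zs. xs ! k \<le> z"
    using xs(1,2) assms by (auto simp: zs_def in_set_conv_nth intro!: sorted_nth_mono)
  \<comment> \<open>A nonempty prefix of nonpositive gap would force a negative gap on the whole
    solution; the empty prefix has gap 1.\<close>
  have "1 \<le> gap ys"
  proof (cases "ys = []")
    case False
    then show ?thesis using gap_append_nonpos[OF ge _ False] zs gap by force
  qed simp
  then have "xs ! k * 1 \<le> xs ! k * gap ys"
    using c by (intro mult_left_mono) auto
  moreover
  have "prod_list zs * (xs ! k * gap ys - int (length zs) * int n * co_sym 0 ys) \<le> 0"
    using gap_append_lower[OF ge le, of n] c xs gap by simp
  moreover have "\<forall>z\<in>set zs. 1 \<le> z" using ge by simp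
  then have "0 < prod_list zs"
    by (induction zs) (simp_all add: zero_less_mult_iff)
  ultimately have "xs ! k \<le> int (length zs) * int n * co_sym 0 ys"
    by (auto simp: mult_le_0_iff)
  also have "\<dots> \<le> int n * int n * co_sym 0 ys"
    using zs co_sym_0_pos[of ys] ge by (intro mult_right_mono) auto
  finally show ?thesis by (simp add: ys_def)
qed

lemma finite_sym_solutions:
  assumes "2 \<le> n"
  shows "finite (sym_solutions (n - 2) n)"
proof -
  \<comment> \<open>Induction on the prefix length: the bound on entry \<open>k\<close> depends only
    on \<open>n\<close> and the prefix before it, so each prefix has finitely many
    continuations.\<close>
  have "finite (take k ` sym_solutions (n - 2) n)" if "k \<le> n" for k
    using that
  proof (induction k)
    case 0
    show ?case by (rule finite_subset[of _ "{[]}"]) auto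
  next
    case (Suc k)
    let ?T = "take k ` sym_solutions (n - 2) n"
    have "take (Suc k) ` sym_solutions (n - 2) n
        \<subseteq> (\<Union>ys\<in>?T. (\<lambda>x. ys @ [x]) ` {1..int n * int n * co_sym 0 ys})"
    proof (intro image_subsetI)
      fix xs assume xs: "xs \<in> sym_solutions (n - 2) n"
      then have "1 \<le> xs ! k" "k < length xs"
        using Suc by (auto simp: sym_solutions_def)
      with xs show "take (Suc k) xs
          \<in> (\<Union>ys\<in>?T. (\<lambda>x. ys @ [x]) ` {1..int n * int n * co_sym 0 ys})"
        using sym_solutions_nth_le[OF xs assms, of k] Suc.prems
        by (intro UN_I[of "take k xs"] image_eqI[of _ _ "xs ! k"])
          (auto simp: take_Suc_conv_app_nth)
    qed
    moreover have "finite ?T" using Suc by simp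
    moreover from this
    have "finite (\<Union>ys\<in>?T. (\<lambda>x. ys @ [x]) ` {1..int n * int n * co_sym 0 ys})"
      by (rule finite_UN_I) (rule finite_imageI, rule finite_atLeastAtMost_int)
    ultimately show ?case using finite_subset by blast
  qed
  from this[of n] show ?thesis
    by (rule finite_subset[rotated]) (force simp: sym_solutions_def image_iff)+
qed

subsection \<open>Tuples of gap 1\<close>

text \<open>The bound of the entries by \<open>A\<close> keeps the tuple sorted when
  \<open>A\<close> or anything larger is appended.\<close>

definition unit_gap :: "nat \<Rightarrow> int list set" where
  "unit_gap m = {xs. length xs = m \<and> sorted xs \<and> (\<forall>x\<in>set xs. 1 \<le> x \<and> x \<le> co_sym (Suc 0) xs) \<and> gap xs = 1}"

text \<open>The new \<open>A\<close> is \<open>P + y * A\<close>, hence at least \<open>y\<close>,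
  so the entry bound is restored. Only the extended tuple must have gap 1, so that \<open>xs\<close>
  may be an intermediate tuple of another gap.\<close>

lemma unit_gap_snoc:
  assumes "length xs = m" "sorted xs" "\<forall>x\<in>set xs. 1 \<le> x \<and> x \<le> b" "xs \<noteq> []" "b \<le> y" "1 \<le> y"
    "gap (xs @ [y]) = 1"
  shows "xs @ [y] \<in> unit_gap (Suc m)"
proof -
  have "1 \<le> co_sym 0 xs" "1 \<le> co_sym (Suc 0) xs"
    using assms by (auto intro: co_sym_0_pos co_sym_1_pos)
  moreover from this have "y * 1 \<le> y * co_sym (Suc 0) xs"
    using assms by (intro mult_left_mono) auto
  ultimately have "y \<le> co_sym (Suc 0) (xs @ [y])" by simp
  with assms show ?thesis
    by (fastforce simp: unit_gap_def sorted_append simp del: co_sym_Suc_snoc)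
qed

definition child :: "int list \<Rightarrow> int list" where
  "child xs = xs @ [co_sym (Suc 0) xs + 1]"

text \<open>The factorization \<open>(u - A) * (v - A) = A * A + P + 1\<close> with
  \<open>u - A = 5\<close>.\<close>

definition grandchild :: "int list \<Rightarrow> int list" where
  "grandchild xs = (let a = co_sym (Suc 0) xs in
     xs @ [a + 5] @ [a + (a\<^sup>2 + co_sym 0 xs + 1) div 5])"

text \<open>The congruences make the division by 5 in \<open>grandchild\<close> exact;
  \<open>5 \<le> A\<close> keeps its last two entries in order.\<close>

definition two_mod_five :: "nat \<Rightarrow> int list set" where
  "two_mod_five m = {xs \<in> unit_gap m. 5 dvd co_sym 0 xs \<and> co_sym (Suc 0) xs mod 5 = 2 \<and> 5 \<le> co_sym (Suc 0) xs}"

lemma unit_gapD: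
  assumes "xs \<in> unit_gap m"
  shows "length xs = m" "sorted xs" "\<forall>x\<in>set xs. 1 \<le> x \<and> x \<le> co_sym (Suc 0) xs"
    "\<forall>x\<in>set xs. 1 \<le> x" "gap xs = 1"
  using assms by (auto simp: unit_gap_def)

lemma child_in_unit_gap:
  assumes "xs \<in> unit_gap m" "0 < m"
  shows "child xs \<in> unit_gap (Suc m)"
  unfolding child_def
proof (rule unit_gap_snoc[where b = "co_sym (Suc 0) xs"])
  have "1 \<le> co_sym (Suc 0) xs"
    using unit_gapD[OF assms(1)] assms(2) by (intro co_sym_1_pos) auto
  then show "1 \<le> co_sym (Suc 0) xs + 1" by simp
qed (use unit_gapD[OF assms(1)] assms(2) in auto)

lemma inj_child: "inj_on child X"
  by (auto simp: inj_on_def child_def)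

text \<open>Modulo 5, with \<open>P\<close> = 0 throughout, a child sends \<open>A\<close> to
  \<open>(A + 1) * A\<close>: from 2 to 1, and from 1 back to 2. Hence two steps are taken.\<close>

lemma child_child_in_two_mod_five:
  assumes "xs \<in> two_mod_five m" "0 < m"
  shows "child (child xs) \<in> two_mod_five (Suc (Suc m))"
proof -
  define a p where "a = co_sym (Suc 0) xs" and "p = co_sym 0 xs"
  have xs: "xs \<in> unit_gap m" "5 dvd p" "a mod 5 = 2" "5 \<le> a"
    using assms by (auto simp: two_mod_five_def a_def p_def)
  have p: "1 \<le> p"
    using unit_gapD[OF xs(1)] unfolding p_def by (intro co_sym_0_pos) auto
  obtain q where q: "p = 5 * q" using xs by blast
  define r where "r = a div 5"
  have r: "a = 5 * r + 2" using xs(3) unfolding r_def by presburger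
  define b where "b = p + (a + 1) * a"
  have b: "b = 5 * (q + 5 * r^2 + 5 * r + 1) + 1"
    unfolding b_def q r by (simp add: algebra_simps power2_eq_square)
  have "b = p + a + a * a" unfolding b_def by (simp add: algebra_simps)
  then have "5 \<le> b" using p xs(4) zero_le_square[of a] by linarith
  obtain t where t: "b = 5 * t + 1" using b by blast
  have "(a + 1) * p + (b + 1) * b = 5 * ((a + 1) * q + 5 * t^2 + 3 * t) + 2"
    unfolding q t by (simp add: algebra_simps power2_eq_square)
  then have mod: "((a + 1) * p + (b + 1) * b) mod 5 = 2" by presburger
  have "0 \<le> (a + 1) * p" using p xs(4) by simp
  moreover have "5 * 1 \<le> (b + 1) * b" using \<open>5 \<le> b\<close> by (intro mult_mono) auto
  ultimately have "5 \<le> (a + 1) * p + (b + 1) * b" by linarith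
  with mod show ?thesis
    using child_in_unit_gap[OF child_in_unit_gap[OF xs(1) assms(2)]] xs(2)
    by (simp add: two_mod_five_def child_def a_def[symmetric] p_def[symmetric] b_def[symmetric]
        flip: append_assoc)
qed

lemma grandchild_in_unit_gap:
  assumes "xs \<in> two_mod_five m" "0 < m"
  shows "grandchild xs \<in> unit_gap (Suc (Suc m))"
proof -
  define a p where "a = co_sym (Suc 0) xs" and "p = co_sym 0 xs"
  define v where "v = a + (a\<^sup>2 + p + 1) div 5"
  have xs: "xs \<in> unit_gap m" "5 dvd p" "a mod 5 = 2" "5 \<le> a"
    using assms by (auto simp: two_mod_five_def a_def p_def)
  note D = unit_gapD[OF xs(1), folded a_def]
  have p: "1 \<le> p"
    using D unfolding p_def by (intro co_sym_0_pos) auto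
  obtain q where q: "p = 5 * q" using xs by blast
  define r where "r = a div 5"
  have r: "a = 5 * r + 2" using xs(3) unfolding r_def by presburger
  have "a\<^sup>2 + p + 1 = 5 * (5 * r^2 + 4 * r + q + 1)"
    unfolding q r by (simp add: algebra_simps power2_eq_square)
  then have v: "5 * v = 5 * a + (a\<^sup>2 + p + 1)" unfolding v_def by simp
  \<comment> \<open>This puts the cofactor \<open>(a * a + p + 1) div 5\<close> at 5 or more, so
    \<open>v\<close> may follow \<open>a + 5\<close>.\<close>
  have "5 * 5 \<le> a * a" using xs(4) by (intro mult_mono) auto
  then have "a + 5 \<le> v" using v p unfolding power2_eq_square by linarith
  have "(xs @ [a + 5]) @ [v] \<in> unit_gap (Suc (Suc m))"
  proof (rule unit_gap_snoc[where b = "a + 5"])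
    show "gap ((xs @ [a + 5]) @ [v]) = 1"
      using v D(5) by (simp add: a_def[symmetric] p_def[symmetric] algebra_simps power2_eq_square
          del: append_assoc)
    show "sorted (xs @ [a + 5])" using D by (fastforce simp: sorted_append)
    show "\<forall>x\<in>set (xs @ [a + 5]). 1 \<le> x \<and> x \<le> a + 5" using D xs(4) by fastforce
  qed (use D \<open>a + 5 \<le> v\<close> xs(4) in auto)
  then show ?thesis
    by (simp add: grandchild_def Let_def a_def[symmetric] p_def[symmetric] v_def[symmetric])
qed

lemma inj_grandchild: "inj_on grandchild X"
  by (auto simp: inj_on_def grandchild_def Let_def)

text \<open>Without its last entry, a child has gap 1 but a grandchild has gap
  \<open>(A + 5) - A = 5\<close>.\<close>

lemma child_neq_grandchild:
  assumes "xs \<in> unit_gap k" "ys \<in> unit_gap m"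
  shows "child xs \<noteq> grandchild ys"
proof
  assume "child xs = grandchild ys"
  then have "butlast (child xs) = butlast (grandchild ys)" by simp
  then have "xs = ys @ [co_sym (Suc 0) ys + 5]"
    by (simp add: child_def grandchild_def Let_def butlast_append)
  then have "gap xs = 5" using unit_gapD(5)[OF assms(2)] by simp
  with unit_gapD(5)[OF assms(1)] show False by simp
qed

section \<open>Counting tuples of gap 1\<close>

text \<open>Appending \<open>A\<close> maps tuples of gap 1 injectively to solutions, so finiteness
  carries over from the solutions.\<close>

lemma card_unit_gap_le:
  assumes "2 \<le> m"
  shows "finite (unit_gap m)" "card (unit_gap m) \<le> num_solutions (m - 1) (Suc m)"
proof -
  let ?f = "\<lambda>xs. xs @ [co_sym (Suc 0) xs]"
  have sub: "?f ` unit_gap m \<subseteq> sym_solutions (Suc m - 2) (Suc m)"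
  proof (intro image_subsetI)
    fix xs assume xs: "xs \<in> unit_gap m"
    note D = unit_gapD[OF this]
    have "1 \<le> co_sym (Suc 0) xs" using D assms by (intro co_sym_1_pos) auto
    moreover have "gap (?f xs) = 0" using D by simp
    then have "elem_sym (Suc m - 2) (?f xs) = elem_sym (Suc m) (?f xs)"
      using gap_eq_0_iff[of "?f xs" "Suc m"] D assms by simp
    ultimately show "?f xs \<in> sym_solutions (Suc m - 2) (Suc m)"
      using D by (auto simp: sym_solutions_def sorted_append)
  qed
  have fin: "finite (sym_solutions (Suc m - 2) (Suc m))"
    using finite_sym_solutions[of "Suc m"] assms by simp
  have inj: "inj_on ?f (unit_gap m)" by (auto simp: inj_on_def)
  show "finite (unit_gap m)"
    using finite_imageD[OF finite_subset[OF sub fin] inj] .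
  show "card (unit_gap m) \<le> num_solutions (m - 1) (Suc m)"
    using card_inj_on_le[OF inj sub fin] assms by (simp add: num_solutions_def numeral_2_eq_2)
qed

lemma card_unit_gap_Suc:
  assumes "2 \<le> m"
  shows "card (unit_gap m) \<le> card (unit_gap (Suc m))"
  using assms child_in_unit_gap card_unit_gap_le(1)[of "Suc m"]
  by (intro card_inj_on_le[OF inj_child]) auto

text \<open>Two disjoint families of length \<open>m + 2\<close>: children of all tuples of length
  \<open>m + 1\<close>, and grandchildren of \<open>two_mod_five m\<close>.\<close>

lemma card_unit_gap_Suc_Suc:
  assumes "2 \<le> m"
  shows "card (unit_gap m) + card (two_mod_five m) \<le> card (unit_gap (Suc (Suc m)))"
proof -
  have fin: "finite (unit_gap k)" if "m \<le> k" for k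
    using card_unit_gap_le(1)[of k] assms that by simp
  have "finite (two_mod_five m)"
    using fin[of m] by (simp add: two_mod_five_def)
  have "card (unit_gap m) + card (two_mod_five m)
      \<le> card (unit_gap (Suc m)) + card (two_mod_five m)"
    using card_unit_gap_Suc[OF assms] by simp
  also have "\<dots> = card (child ` unit_gap (Suc m)) + card (grandchild ` two_mod_five m)"
    by (simp add: card_image inj_child inj_grandchild)
  also have "\<dots> = card (child ` unit_gap (Suc m) \<union> grandchild ` two_mod_five m)"
  proof (rule card_Un_disjoint[symmetric])
    show "child ` unit_gap (Suc m) \<inter> grandchild ` two_mod_five m = {}"
      using child_neq_grandchild by (fastforce simp: two_mod_five_def)
  qed (use fin[of "Suc m"] \<open>finite (two_mod_five m)\<close> in auto)
  also have "\<dots> \<le> card (unit_gap (Suc (Suc m)))"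
    using fin[of "Suc (Suc m)"] child_in_unit_gap grandchild_in_unit_gap assms
    by (intro card_mono) auto
  finally show ?thesis .
qed

lemma card_two_mod_five_Suc_Suc:
  assumes "2 \<le> m"
  shows "card (two_mod_five m) \<le> card (two_mod_five (Suc (Suc m)))"
proof (rule card_inj_on_le)
  show "inj_on (\<lambda>xs. child (child xs)) (two_mod_five m)"
    by (auto simp: inj_on_def child_def)
  show "(\<lambda>xs. child (child xs)) ` two_mod_five m \<subseteq> two_mod_five (Suc (Suc m))"
    using child_child_in_two_mod_five assms by auto
  show "finite (two_mod_five (Suc (Suc m)))"
    using card_unit_gap_le(1)[of "Suc (Suc m)"] by (simp add: two_mod_five_def)
qed

section \<open>Explicit short tuples and the final count\<close>

lemma card_unit_gap_3: "1 \<le> card (unit_gap 3)"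
proof -
  have "{[1, 2, 4]} \<subseteq> unit_gap 3"
    using co_sym_foldl[of "[1, 2, 4]"] by (simp add: unit_gap_def)
  from card_mono[OF card_unit_gap_le(1) this] show ?thesis by simp
qed

lemma card_unit_gap_4: "2 \<le> card (unit_gap 4)"
proof -
  have "{[1, 2, 4, 15], [1, 2, 5, 9]} \<subseteq> unit_gap 4"
    using co_sym_foldl[of "[1, 2, 4, 15]"] co_sym_foldl[of "[1, 2, 5, 9]"]
    by (simp add: unit_gap_def)
  from card_mono[OF card_unit_gap_le(1) this] show ?thesis by simp
qed

lemma card_unit_gap_5: "4 \<le> card (unit_gap 5)"
proof -
  \<comment> \<open>The first three are children of \<open>[1, 2, 4, 15]\<close>,
    \<open>[1, 2, 5, 9]\<close> and \<open>[1, 2, 6, 7]\<close>; the last is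
    \<open>grandchild [1, 2, 4]\<close>, where \<open>A = 14\<close> and
    \<open>A * A + P + 1 = 205\<close>.\<close>
  have "{[1, 2, 4, 15, 219], [1, 2, 5, 9, 164], [1, 2, 6, 7, 153], [1, 2, 4, 19, 55]} \<subseteq> unit_gap 5"
    using co_sym_foldl[of "[1, 2, 4, 15, 219]"] co_sym_foldl[of "[1, 2, 5, 9, 164]"]
      co_sym_foldl[of "[1, 2, 6, 7, 153]"] co_sym_foldl[of "[1, 2, 4, 19, 55]"]
    by (simp add: unit_gap_def)
  from card_mono[OF card_unit_gap_le(1) this] show ?thesis by simp
qed

lemma card_two_mod_five_5: "2 \<le> card (two_mod_five 5)"
proof -
  have "{[1, 2, 4, 15, 219], [1, 2, 5, 9, 164]} \<subseteq> two_mod_five 5"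
    using co_sym_foldl[of "[1, 2, 4, 15, 219]"] co_sym_foldl[of "[1, 2, 5, 9, 164]"]
    by (simp add: unit_gap_def two_mod_five_def)
  moreover have "finite (two_mod_five 5)"
    using card_unit_gap_le(1)[of 5] by (simp add: two_mod_five_def)
  ultimately have "card {[1, 2, 4, 15, 219 :: int], [1, 2, 5, 9, 164]} \<le> card (two_mod_five 5)"
    by (intro card_mono)
  then show ?thesis by simp
qed

text \<open>Every two steps in length gain at least two tuples. At length
  \<open>m = 5 + 2 * k\<close> this gives \<open>m - 1\<close>, one more than required; the surplus
  pays for the next even length, where only monotonicity is used.\<close>

lemma card_unit_gap_odd:
  "2 \<le> card (two_mod_five (5 + 2 * k)) \<and> 4 + 2 * k \<le> card (unit_gap (5 + 2 * k))"
proof (induction k)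
  case 0
  show ?case using card_unit_gap_5 card_two_mod_five_5 by simp
next
  case (Suc k)
  then show ?case
    using card_unit_gap_Suc_Suc[of "5 + 2 * k"] card_two_mod_five_Suc_Suc[of "5 + 2 * k"]
    by (simp add: eval_nat_numeral)
qed

lemma card_unit_gap_ge:
  assumes "3 \<le> m"
  shows "m - 2 \<le> card (unit_gap m)"
proof -
  consider "m = 3" | "m = 4" | k where "m = 5 + 2 * k" | k where "m = Suc (5 + 2 * k)"
  proof (cases "5 \<le> m")
    case True
    then obtain l where "m = 5 + l" using le_Suc_ex by blast
    moreover have "l = 2 * (l div 2) \<or> l = Suc (2 * (l div 2))" by presburger
    ultimately show ?thesis using that(3,4)[of "l div 2"] by auto
  next
    case False
    with assms show ?thesis using that(1,2) by linarith
  qed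
  then show ?thesis
  proof cases
    case 1
    then show ?thesis using card_unit_gap_3 by simp
  next
    case 2
    then show ?thesis using card_unit_gap_4 by simp
  next
    case (3 k)
    then show ?thesis using card_unit_gap_odd[of k] by simp
  next
    case (4 k)
    then show ?thesis using card_unit_gap_odd[of k] card_unit_gap_Suc[of "5 + 2 * k"] by simp
  qed
qed

theorem theorem15:
  fixes n :: nat
  assumes "n \<ge> 4"
  shows "num_solutions (n - 2) n \<ge> n - 3"
proof -
  obtain m where m: "n = Suc m" "3 \<le> m"
    using assms by (cases n) auto
  have "n - 3 = m - 2" "n - 2 = m - 1" using m by auto
  then show ?thesis
    using card_unit_gap_ge[OF m(2)] card_unit_gap_le(2)[of m] m by simp
qed

end
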